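(* Let $T$ be a countable nontrivial tree. Then the following are equivalent: $T$ is $\mathrm{I\overline{E}}$; $T$ is $\mathrm{\overline{H}\,\overline{E}}$; for each $x\in T$ there is $y\in T$ with $x\parallel y$. Furthermore, the following are equivalent: $T$ is $\mathrm{IE}$; $T$ is both $\mathrm{HE}$ and $\mathrm{MB}$; $T$ is $\mathrm{IH}$ and for each $x\in T$ there is $y\in T$ with $x\parallel y$.
   Context: A tree is a connected partial order $T$ such that for all $x\in T$ the set $\{z\in T: z<x\}$ is a chain; it is nontrivial if it contains two incomparable points. $x\parallel y$ means $x,y$ are incomparable. Let $P$ be a poset. Finite partial maps are maps from a finite subset of $P$ to $P$. Kinds of finite partial map: $\mathrm{\overline{H}}$: preserves $\le$; $\mathrm{H}$: preserves $<$; $\mathrm{M}$: injective and preserves $<$; $\mathrm{I}$: an isomorphism between finite induced subposets. Kinds of total map $P\to P$: $\mathrm{H}$: preserves $<$; $\mathrm{\overline{E}}$: surjective and preserves $\le$; $\mathrm{E}$: surjective and preserves $<$; $\mathrm{B}$: bijective and preserves $<$. For a kind $X$ of finite partial map and a kind $Y$ of total map, $P$ is $XY$ if every finite partial map of kind $X$ on $P$ extends to a map $P\to P$ of kind $Y$. *)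

theory Defs
  imports "HOL-Library.Countable_Set" "HOL-Library.FuncSet"
begin

text \<open>
  A poset is a set P of elements of a type of class \<open>order\<close>, with the induced order
  (an arbitrary partially ordered type is the case \<open>P = UNIV\<close>).
\<close>

definition incomparable :: "'a::order \<Rightarrow> 'a \<Rightarrow> bool" (infix "\<parallel>" 50)
  where "x \<parallel> y \<longleftrightarrow> \<not> x \<le> y \<and> \<not> y \<le> x"

text \<open>Connectedness is that of the comparability graph: any two points of P are joined by a
  finite path in P whose consecutive members are comparable.\<close>

definition connected_poset :: "'a::order set \<Rightarrow> bool"
  where "connected_poset P \<longleftrightarrow>
    (\<forall>x\<in>P. \<forall>y\<in>P. (x, y) \<in> {(u, v). u \<in> P \<and> v \<in> P \<and> (u \<le> v \<or> v \<le> u)}\<^sup>*)"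

definition tree :: "'a::order set \<Rightarrow> bool"
  where "tree T \<longleftrightarrow>
    connected_poset T \<and> (\<forall>x\<in>T. Complete_Partial_Order.chain (\<le>) {z\<in>T. z < x})"

definition nontrivial :: "'a::order set \<Rightarrow> bool"
  where "nontrivial T \<longleftrightarrow> (\<exists>x\<in>T. \<exists>y\<in>T. x \<parallel> y)"

text \<open>A kind of map takes the domain and the map; only the values on the domain matter.
  The kinds of partial map are applied to a finite \<open>A \<subseteq> P\<close> and \<open>p \<in> A \<rightarrow> P\<close>,
  those of total map to \<open>P\<close> itself and \<open>f \<in> P \<rightarrow> P\<close>.\<close>

type_synonym 'a map_kind = "'a set \<Rightarrow> ('a \<Rightarrow> 'a) \<Rightarrow> bool"

definition partial_Hbar :: "'a::order map_kind"
  where "partial_Hbar A p \<longleftrightarrow> mono_on A p"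

definition partial_H :: "'a::order map_kind"
  where "partial_H A p \<longleftrightarrow> strict_mono_on A p"

definition partial_M :: "'a::order map_kind"
  where "partial_M A p \<longleftrightarrow> inj_on p A \<and> strict_mono_on A p"

definition partial_I :: "'a::order map_kind"
  where "partial_I A p \<longleftrightarrow> inj_on p A \<and> (\<forall>x\<in>A. \<forall>y\<in>A. p x \<le> p y \<longleftrightarrow> x \<le> y)"

definition total_H :: "'a::order map_kind"
  where "total_H P f \<longleftrightarrow> strict_mono_on P f"

definition total_Ebar :: "'a::order map_kind"
  where "total_Ebar P f \<longleftrightarrow> f ` P = P \<and> mono_on P f"

definition total_E :: "'a::order map_kind"
  where "total_E P f \<longleftrightarrow> f ` P = P \<and> strict_mono_on P f"

definition total_B :: "'a::order map_kind"
  where "total_B P f \<longleftrightarrow> bij_betw f P P \<and> strict_mono_on P f"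

definition extends_to :: "'a::order map_kind \<Rightarrow> 'a map_kind \<Rightarrow> 'a set \<Rightarrow> bool"
  where "extends_to X Y P \<longleftrightarrow>
    (\<forall>A p. finite A \<and> A \<subseteq> P \<and> p \<in> A \<rightarrow> P \<and> X A p \<longrightarrow>
      (\<exists>f. f \<in> P \<rightarrow> P \<and> Y P f \<and> (\<forall>x\<in>A. f x = p x)))"

end

theory Submission
  imports Defs
begin

text \<open>
  Countable back-and-forth. In a tree every finite set has a lower bound \<open>l\<close>, and a point
  incomparable to \<open>l\<close> is incomparable to the whole set. Hence, if every point has an
  incomparable one, any prescribed value can be added to a finite partial map at such a new point,
  which gives surjectivity for free. If some point \<open>x\<close> is comparable to everything, then it
  lies below two incomparable points \<open>y\<close>, \<open>z\<close>, and a map taking \<open>x\<close> to \<open>y\<close> misses \<open>z\<close>.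

  It remains to extend the domain. For maps preserving \<open>\<le>\<close> the value at the largest smaller
  point of the domain, or else a lower bound of the values, will do. For strict maps, IH together
  with the incomparability condition makes the tree dense and without minimal or maximal points;
  moreover, if \<open>d < x < u\<^sub>1, u\<^sub>2\<close> for some incomparable \<open>u\<^sub>1\<close>, \<open>u\<^sub>2\<close>, then IH moves this
  configuration above any \<open>a < v\<^sub>1, v\<^sub>2\<close>, so a point can be inserted between \<open>a\<close> and any
  finite set above \<open>a\<close>.
\<close>

section \<open>Back-and-forth\<close>

text \<open>\<open>R x y u v\<close> is the condition on a pair \<open>x\<close>, \<open>y\<close>
  with images \<open>u\<close>, \<open>v\<close>; its instances below encode preservation of \<le>,
  preservation of <, and the latter with injectivity. Enumerations of \<open>S\<close> and
  \<open>T\<close> are worked through alternately, and \<open>f\<close> is the union of the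
  resulting increasing chain of finite maps. In \<open>hit\<close> the new point lies outside
  \<open>A\<close>, so no value already fixed is overwritten.\<close>

lemma back_and_forth:
  fixes R :: "'a \<Rightarrow> 'a \<Rightarrow> 'b \<Rightarrow> 'b \<Rightarrow> bool"
  assumes "countable S" "countable T" and A: "finite A" "A \<subseteq> S" "p \<in> A \<rightarrow> T"
    and R: "\<forall>x\<in>A. \<forall>y\<in>A. R x y (p x) (p y)"
    and forth: "\<And>A p x. finite A \<Longrightarrow> A \<subseteq> S \<Longrightarrow> p \<in> A \<rightarrow> T \<Longrightarrow> \<forall>x\<in>A. \<forall>y\<in>A. R x y (p x) (p y)
      \<Longrightarrow> x \<in> S \<Longrightarrow> x \<notin> A \<Longrightarrow> \<exists>y\<in>T. R x x y y \<and> (\<forall>a\<in>A. R a x (p a) y \<and> R x a y (p a))"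
    and hit: "\<And>A p y. finite A \<Longrightarrow> A \<subseteq> S \<Longrightarrow> p \<in> A \<rightarrow> T \<Longrightarrow> \<forall>x\<in>A. \<forall>y\<in>A. R x y (p x) (p y)
      \<Longrightarrow> y \<in> T \<Longrightarrow> y \<notin> p ` A
      \<Longrightarrow> \<exists>x\<in>S. x \<notin> A \<and> R x x y y \<and> (\<forall>a\<in>A. R a x (p a) y \<and> R x a y (p a))"
  shows "\<exists>f. f \<in> S \<rightarrow> T \<and> f ` S = T \<and> (\<forall>x\<in>S. \<forall>y\<in>S. R x y (f x) (f y)) \<and> (\<forall>x\<in>A. f x = p x)"
proof -
  \<comment> \<open>A state pairs a finite domain with a function whose values off that domain carry
    no information; hence \<open>ext\<close> compares values on the smaller domain only.\<close>
  define good where "good = (\<lambda>(A, p). finite A \<and> A \<subseteq> S \<and> p \<in> A \<rightarrow> T \<and>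
    (\<forall>x\<in>A. \<forall>y\<in>A. R x y (p x) (p y)))"
  define ext where "ext = (\<lambda>(A::'a set, p::'a \<Rightarrow> 'b) (A', p'). A \<subseteq> A' \<and> (\<forall>x\<in>A. p' x = p x))"
  have ext_refl: "ext s s" for s by (auto simp: ext_def)
  have ext_trans: "ext s s' \<Longrightarrow> ext s' s'' \<Longrightarrow> ext s s''" for s s' s''
    unfolding ext_def by (auto split: prod.splits)
  have add: "good (insert x A, p(x := y)) \<and> ext (A, p) (insert x A, p(x := y))"
    if "good (A, p)" "x \<in> S" "x \<notin> A" "y \<in> T" "R x x y y"
      "\<forall>a\<in>A. R a x (p a) y \<and> R x a y (p a)" for A p x y
    using that unfolding good_def ext_def by auto
  have dom: "\<exists>s'. good s' \<and> ext s s' \<and> x \<in> fst s'" if s_x: "good s" "x \<in> S" for s x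
  proof (cases "x \<in> fst s")
    case True
    then show ?thesis using that ext_refl by blast
  next
    case False
    obtain B q where s: "s = (B, q)" by force
    obtain y where "y \<in> T" "R x x y y" "\<forall>a\<in>B. R a x (q a) y \<and> R x a y (q a)"
      using forth[of B q x] s_x False s by (auto simp: good_def)
    with add[of B q x y] that False s show ?thesis by fastforce
  qed
  have ran: "\<exists>s'. good s' \<and> ext s s' \<and> y \<in> snd s' ` fst s'" if s_y: "good s" "y \<in> T" for s y
  proof (cases "y \<in> snd s ` fst s")
    case True
    then show ?thesis using that ext_refl by blast
  next
    case False
    obtain B q where s: "s = (B, q)" by force
    obtain x where "x \<in> S" "x \<notin> B" "R x x y y" "\<forall>a\<in>B. R a x (q a) y \<and> R x a y (q a)"
      using hit[of B q y] s_y False s by (auto simp: good_def)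
    with add[of B q x y] that False s show ?thesis by fastforce
  qed
  \<comment> \<open>Step \<open>n\<close> puts the \<open>n\<close>-th point of \<open>S\<close>
    into the domain and the \<open>n\<close>-th point of \<open>T\<close> into the range. The guards
    are there because \<open>from_nat_into\<close> of the empty set has no member to return.\<close>
  have step: "\<exists>s'. good s' \<and> ext s s' \<and> (S \<noteq> {} \<longrightarrow> from_nat_into S n \<in> fst s') \<and>
      (T \<noteq> {} \<longrightarrow> from_nat_into T n \<in> snd s' ` fst s')" if s_n: "good s" for s n
  proof -
    obtain s1 where s1: "good s1" "ext s s1" "S \<noteq> {} \<longrightarrow> from_nat_into S n \<in> fst s1"
      using dom[OF s_n from_nat_into] ext_refl[of s] s_n by blast
    obtain s2 where s2: "good s2" "ext s1 s2" "T \<noteq> {} \<longrightarrow> from_nat_into T n \<in> snd s2 ` fst s2"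
      using ran[OF s1(1) from_nat_into] ext_refl[of s1] s1(1) by blast
    have "fst s1 \<subseteq> fst s2" using s2(2) by (auto simp: ext_def)
    then show ?thesis
      using s1 s2 ext_trans[OF s1(2) s2(2)] by (intro exI[of _ s2]) auto
  qed
  have "\<exists>s. \<forall>n. (good (s n) \<and> (n = 0 \<longrightarrow> s n = (A, p))) \<and>
      (ext (s n) (s (Suc n)) \<and> (S \<noteq> {} \<longrightarrow> from_nat_into S n \<in> fst (s (Suc n))) \<and>
      (T \<noteq> {} \<longrightarrow> from_nat_into T n \<in> snd (s (Suc n)) ` fst (s (Suc n))))"
  proof (rule dependent_nat_choice)
    show "\<exists>s. good s \<and> (0 = 0 \<longrightarrow> s = (A, p))" using A R by (auto simp: good_def)
  qed (use step in simp)
  then obtain s where good: "\<And>n. good (s n)" and s0: "s 0 = (A, p)"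
    and ext: "\<And>n. ext (s n) (s (Suc n))"
    and domS: "\<And>n. S \<noteq> {} \<Longrightarrow> from_nat_into S n \<in> fst (s (Suc n))"
    and ranT: "\<And>n. T \<noteq> {} \<Longrightarrow> from_nat_into T n \<in> snd (s (Suc n)) ` fst (s (Suc n))"
    by blast
  have ext_le: "ext (s m) (s n)" if "m \<le> n" for m n
    using that by (induction rule: dec_induct) (auto intro: ext_refl ext_trans ext)
  \<comment> \<open>Step \<open>n\<close> acts on stage \<open>n\<close>, so the \<open>n\<close>-th
    point is certain to be in the domain at stage \<open>Suc n\<close>. By \<open>f_eq\<close>,
    every stage containing \<open>x\<close> gives the same value.\<close>
  define f where "f x = snd (s (Suc (to_nat_on S x))) x" for x
  have mem: "x \<in> fst (s (Suc (to_nat_on S x)))" if "x \<in> S" for x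
    using domS[of "to_nat_on S x"] that \<open>countable S\<close> by auto
  have sub: "fst (s n) \<subseteq> S" for n using good[of n] by (auto simp: good_def)
  have f_eq: "f x = snd (s n) x" if "x \<in> fst (s n)" for x n
  proof -
    have "x \<in> S" using sub that by blast
    define m where "m = Suc (to_nat_on S x)"
    have "x \<in> fst (s m)" using mem[OF \<open>x \<in> S\<close>] by (simp add: m_def)
    then have "snd (s m) x = snd (s n) x"
      using that ext_le[of m n] ext_le[of n m] nat_le_linear[of m n]
      by (auto simp: ext_def split: prod.splits)
    then show ?thesis by (simp add: f_def m_def)
  qed
  have f_in: "f x \<in> T" if "x \<in> S" for x
    using mem[OF that] good[of "Suc (to_nat_on S x)"] by (auto simp: good_def f_def)
  have "T \<subseteq> f ` S"
  proof
    fix y assume "y \<in> T"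
    define n where "n = Suc (to_nat_on T y)"
    have "y \<in> snd (s n) ` fst (s n)"
      using ranT[of "to_nat_on T y"] \<open>y \<in> T\<close> \<open>countable T\<close> by (auto simp: n_def)
    then obtain x where "x \<in> fst (s n)" "y = snd (s n) x" by blast
    then show "y \<in> f ` S" using f_eq[of x n] sub[of n] by (intro image_eqI[of _ _ x]) auto
  qed
  moreover have "R x y (f x) (f y)" if "x \<in> S" "y \<in> S" for x y
  proof -
    obtain n where n: "x \<in> fst (s n)" "y \<in> fst (s n)"
    proof
      let ?n = "max (Suc (to_nat_on S x)) (Suc (to_nat_on S y))"
      show "x \<in> fst (s ?n)"
        using mem[OF \<open>x \<in> S\<close>] ext_le[of "Suc (to_nat_on S x)" ?n]
        by (auto simp: ext_def split: prod.splits)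
      show "y \<in> fst (s ?n)"
        using mem[OF \<open>y \<in> S\<close>] ext_le[of "Suc (to_nat_on S y)" ?n]
        by (auto simp: ext_def split: prod.splits)
    qed
    then show ?thesis
      using good[of n] f_eq[OF n(1)] f_eq[OF n(2)] by (auto simp: good_def)
  qed
  moreover have "\<forall>x\<in>A. f x = p x" using f_eq[of _ 0] s0 by simp
  ultimately show ?thesis using f_in by (intro exI[of _ f]) auto
qed

section \<open>Trees\<close>

lemma tree_below_comparable:
  assumes "tree T" "x \<in> T" "y \<in> T" "z \<in> T" "x \<le> z" "y \<le> z"
  shows "x \<le> y \<or> y \<le> x"
proof (cases "x = z \<or> y = z")
  case False
  with assms have "x \<in> {w\<in>T. w < z}" "y \<in> {w\<in>T. w < z}" by auto
  moreover have "Complete_Partial_Order.chain (\<le>) {w\<in>T. w < z}"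
    using assms(1,4) by (simp add: tree_def)
  ultimately show ?thesis unfolding Complete_Partial_Order.chain_def by blast
qed (use assms in auto)

text \<open>Follow a comparability path from \<open>x\<close>, keeping a common lower bound
  \<open>z\<close> of \<open>x\<close> and the current point \<open>u\<close>. An upward step keeps
  \<open>z\<close>. After a downward step to \<open>v\<close>, both \<open>z\<close> and
  \<open>v\<close> are below \<open>u\<close>, hence comparable, and the smaller of them
  serves.\<close>

lemma tree_lower_bound2:
  assumes T: "tree T" and "x \<in> T" "y \<in> T"
  shows "\<exists>z\<in>T. z \<le> x \<and> z \<le> y"
proof -
  have "(x, y) \<in> {(u, v). u \<in> T \<and> v \<in> T \<and> (u \<le> v \<or> v \<le> u)}\<^sup>*"
    using assms by (auto simp: tree_def connected_poset_def)
  then show ?thesis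
  proof (induction rule: rtrancl_induct)
    case base
    then show ?case using \<open>x \<in> T\<close> by auto
  next
    case (step u v)
    then obtain z where z: "z \<in> T" "z \<le> x" "z \<le> u" by auto
    from step.hyps have uv: "u \<in> T" "v \<in> T" "u \<le> v \<or> v \<le> u" by auto
    have "z \<le> v \<or> v \<le> z"
      using uv(3) tree_below_comparable[OF T z(1) uv(2) uv(1) z(3)] order.trans[OF z(3), of v]
      by blast
    then show ?case
    proof
      assume "v \<le> z"
      then have "v \<le> x" using z(2) by (rule order.trans)
      then show ?case using uv(2) by blast
    qed (use z in blast)
  qed
qed

lemma tree_lower_bound:
  assumes "tree T" "T \<noteq> {}" "finite A" "A \<subseteq> T"
  shows "\<exists>z\<in>T. \<forall>a\<in>A. z \<le> a"
  using assms(3,4)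
proof (induction A)
  case empty
  then show ?case using \<open>T \<noteq> {}\<close> by blast
next
  case (insert a A)
  then obtain z where "z \<in> T" "\<forall>a\<in>A. z \<le> a" by auto
  moreover obtain w where "w \<in> T" "w \<le> z" "w \<le> a"
    using tree_lower_bound2[OF assms(1), of z a] insert.prems calculation by auto
  ultimately show ?case by (intro bexI[of _ w]) auto
qed

text \<open>The incomparability condition from both halves of the theorem; a point violating it is
  comparable to the whole tree.\<close>

definition unspined :: "'a::order set \<Rightarrow> bool"
  where "unspined T \<longleftrightarrow> (\<forall>x\<in>T. \<exists>y\<in>T. x \<parallel> y)"

text \<open>Let \<open>z\<close> be a lower bound of \<open>A\<close> and
  \<open>z \<parallel> x\<close>. If \<open>a \<le> x\<close>, then \<open>z \<le> x\<close>; if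
  \<open>x \<le> a\<close>, then \<open>x\<close> and \<open>z\<close> are both below
  \<open>a\<close>, so comparable. Either contradicts the choice of \<open>x\<close>.\<close>

lemma tree_incomparable_to_finite:
  assumes T: "tree T" "T \<noteq> {}" "unspined T" and A: "finite A" "A \<subseteq> T"
  shows "\<exists>x\<in>T. \<forall>a\<in>A. x \<parallel> a"
proof -
  obtain z where z: "z \<in> T" "\<forall>a\<in>A. z \<le> a" using tree_lower_bound[OF T(1,2) A] by blast
  obtain x where x: "x \<in> T" "z \<parallel> x" using T(3) z(1) by (auto simp: unspined_def)
  have "x \<parallel> a" if "a \<in> A" for a
  proof -
    have "a \<in> T" "z \<le> a" using that A(2) z(2) by auto
    then show ?thesis
      using tree_below_comparable[OF T(1) x(1) z(1)] order.trans[of z a x] x(2)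
      unfolding incomparable_def by blast
  qed
  with x(1) show ?thesis by blast
qed

text \<open>The points below \<open>x\<close> form a chain, so a maximal one among finitely many is
  the largest.\<close>

lemma tree_max_below:
  assumes T: "tree T" and A: "finite A" "A \<subseteq> T" and x: "x \<in> T" and ne: "\<exists>a\<in>A. a < x"
  shows "\<exists>d\<in>A. d < x \<and> (\<forall>a\<in>A. a < x \<longrightarrow> a \<le> d)"
proof -
  obtain d where d: "d \<in> {a\<in>A. a < x}" "\<And>b. b \<in> {a\<in>A. a < x} \<Longrightarrow> d \<le> b \<Longrightarrow> d = b"
    using finite_has_maximal[of "{a\<in>A. a < x}"] A(1) ne by auto
  have "a \<le> d" if "a \<in> A" "a < x" for a
  proof -
    have "a \<le> d \<or> d \<le> a"
      using tree_below_comparable[OF T _ _ x, of a d] that d(1) A(2) by (auto simp: less_imp_le)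
    with d(2)[of a] that show ?thesis by auto
  qed
  then show ?thesis using d(1) by blast
qed

text \<open>A one-point map is a partial isomorphism, so a point \<open>x\<close> comparable to
  everything may be sent to \<open>y\<close>. All values of the extension are then comparable to
  \<open>y\<close>, and a point \<open>z \<parallel> y\<close> is missed.\<close>

lemma unspined_if_extends_I_Ebar:
  assumes T: "tree T" "nontrivial T" and ext: "extends_to partial_I total_Ebar T"
  shows "unspined T"
proof (rule ccontr)
  assume "\<not> unspined T"
  then obtain x where x: "x \<in> T" "\<forall>y\<in>T. x \<le> y \<or> y \<le> x"
    by (auto simp: unspined_def incomparable_def)
  obtain y z where yz: "y \<in> T" "z \<in> T" "y \<parallel> z" using T(2) by (auto simp: nontrivial_def)
  have "finite {x} \<and> {x} \<subseteq> T \<and> (\<lambda>_. y) \<in> {x} \<rightarrow> T \<and> partial_I {x} (\<lambda>_. y)"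
    using x yz by (auto simp: partial_I_def)
  then obtain f where f: "total_Ebar T f" "f x = y"
    using ext[unfolded extends_to_def, rule_format, of "{x}" "\<lambda>_. y"] by blast
  then have f_T: "f ` T = T" and mono: "mono_on T f" by (simp_all add: total_Ebar_def)
  have "z \<in> f ` T" using yz(2) f_T by simp
  then obtain w where w: "w \<in> T" "f w = z" by blast
  then have "f x \<le> f w \<or> f w \<le> f x"
    using x mono_onD[OF mono x(1) w(1)] mono_onD[OF mono w(1) x(1)] by blast
  with f w yz show False by (simp add: incomparable_def)
qed

section \<open>Comparison of the kinds of map, and extension of maps preserving \<le>\<close>

lemma partial_I_imp_partial_H: "partial_I A p \<Longrightarrow> partial_H A p"
  unfolding partial_I_def partial_H_def strict_mono_on_def inj_on_def less_le by blast

lemma partial_I_imp_partial_Hbar: "partial_I A p \<Longrightarrow> partial_Hbar A p"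
  unfolding partial_I_def partial_Hbar_def mono_on_def by blast

lemma total_E_imp_total_Ebar: "total_E P f \<Longrightarrow> total_Ebar P f"
  unfolding total_E_def total_Ebar_def using strict_mono_on_imp_mono_on by blast

lemma extends_to_weaken:
  assumes "extends_to X Y P" "\<And>A p. X' A p \<Longrightarrow> X A p" "\<And>f. Y P f \<Longrightarrow> Y' P f"
  shows "extends_to X' Y' P"
  unfolding extends_to_def
proof (intro allI impI)
  fix A p assume "finite A \<and> A \<subseteq> P \<and> p \<in> A \<rightarrow> P \<and> X' A p"
  then obtain f where "f \<in> P \<rightarrow> P \<and> Y P f \<and> (\<forall>x\<in>A. f x = p x)"
    using assms(1)[unfolded extends_to_def, rule_format, of A p] assms(2)[of A p] by blast
  then show "\<exists>f. f \<in> P \<rightarrow> P \<and> Y' P f \<and> (\<forall>x\<in>A. f x = p x)"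
    using assms(3)[of f] by blast
qed

lemma extends_Hbar_Ebar:
  assumes "countable T" and T: "tree T" "T \<noteq> {}" "unspined T"
  shows "extends_to partial_Hbar total_Ebar T"
  unfolding extends_to_def
proof (intro allI impI, elim conjE)
  fix A and p :: "'a \<Rightarrow> 'a"
  assume A: "finite A" "A \<subseteq> T" "p \<in> A \<rightarrow> T" and p: "partial_Hbar A p"
  have "\<exists>f. f \<in> T \<rightarrow> T \<and> f ` T = T \<and> (\<forall>x\<in>T. \<forall>y\<in>T. x \<le> y \<longrightarrow> f x \<le> f y) \<and> (\<forall>x\<in>A. f x = p x)"
  proof (rule back_and_forth[OF \<open>countable T\<close> \<open>countable T\<close> A])
    show "\<forall>x\<in>A. \<forall>y\<in>A. x \<le> y \<longrightarrow> p x \<le> p y"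
      using p by (auto simp: partial_Hbar_def mono_on_def)
  next
    fix A and p :: "'a \<Rightarrow> 'a" and x
    assume A: "finite A" "A \<subseteq> T" "p \<in> A \<rightarrow> T" "\<forall>x\<in>A. \<forall>y\<in>A. x \<le> y \<longrightarrow> p x \<le> p y"
      and x: "x \<in> T" "x \<notin> A"
    show "\<exists>y\<in>T. (x \<le> x \<longrightarrow> y \<le> y) \<and> (\<forall>a\<in>A. (a \<le> x \<longrightarrow> p a \<le> y) \<and> (x \<le> a \<longrightarrow> y \<le> p a))"
    proof (cases "\<exists>a\<in>A. a < x")
      case True
      then obtain d where d: "d \<in> A" "d < x" "\<forall>a\<in>A. a < x \<longrightarrow> a \<le> d"
        using tree_max_below[OF T(1) A(1,2) x(1)] by blast
      \<comment> \<open>The new value is \<open>p d\<close>: everything in \<open>A\<close> below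
        \<open>x\<close> is below \<open>d\<close>, and everything above \<open>x\<close> is above
        \<open>d\<close>.\<close>
      have "p a \<le> p d" if "a \<in> A" "a \<le> x" for a
        using that A(4) d x by (metis order.order_iff_strict)
      moreover have "p d \<le> p a" if "a \<in> A" "x \<le> a" for a
        using that A(4) d by (meson order.strict_implies_order order.trans)
      ultimately show ?thesis using d(1) A(3) by blast
    next
      case False
      obtain z where "z \<in> T" "\<forall>a\<in>p ` A. z \<le> a"
        using tree_lower_bound[OF T(1,2), of "p ` A"] A by blast
      moreover have "\<not> a \<le> x" if "a \<in> A" for a using that False x by (auto simp: order.order_iff_strict)
      ultimately show ?thesis by blast
    qed
  next
    fix A and p :: "'a \<Rightarrow> 'a" and y
    assume A: "finite A" "A \<subseteq> T"
    show "\<exists>x\<in>T. x \<notin> A \<and> (x \<le> x \<longrightarrow> y \<le> y) \<and>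
        (\<forall>a\<in>A. (a \<le> x \<longrightarrow> p a \<le> y) \<and> (x \<le> a \<longrightarrow> y \<le> p a))"
      \<comment> \<open>At a point incomparable to all of \<open>A\<close> every required
        implication is vacuous, so \<open>y\<close> is an admissible value.\<close>
      using tree_incomparable_to_finite[OF T A] by (fastforce simp: incomparable_def)
  qed
  then show "\<exists>f. f \<in> T \<rightarrow> T \<and> total_Ebar T f \<and> (\<forall>x\<in>A. f x = p x)"
    by (auto simp: total_Ebar_def mono_on_def)
qed

section \<open>Strict maps\<close>

text \<open>A common lower bound of \<open>x\<close> and a point incomparable to \<open>x\<close>
  cannot equal \<open>x\<close>.\<close>

lemma unspined_no_minimal:
  assumes "tree T" "unspined T" "x \<in> T"
  shows "\<exists>y\<in>T. y < x"
proof -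
  obtain y where y: "y \<in> T" "x \<parallel> y" using assms(2,3) unfolding unspined_def by blast
  obtain z where z: "z \<in> T" "z \<le> x" "z \<le> y"
    using tree_lower_bound2[OF assms(1,3) y(1)] by blast
  with y have "z < x" by (auto simp: less_le incomparable_def)
  with z(1) show ?thesis by blast
qed

lemma extends_I_HD:
  assumes "extends_to partial_I total_H T" "finite A" "A \<subseteq> T" "p \<in> A \<rightarrow> T" "partial_I A p"
  obtains f where "f \<in> T \<rightarrow> T" "\<forall>x\<in>T. \<forall>y\<in>T. x < y \<longrightarrow> f x < f y" "\<forall>x\<in>A. f x = p x"
proof -
  have "finite A \<and> A \<subseteq> T \<and> p \<in> A \<rightarrow> T \<and> partial_I A p" using assms(2-5) by simp
  then obtain f where "f \<in> T \<rightarrow> T" "total_H T f" "\<forall>x\<in>A. f x = p x"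
    using assms(1)[unfolded extends_to_def, rule_format, of A p] by (elim exE conjE) auto
  then show thesis using that[of f] by (simp add: total_H_def strict_mono_on_def)
qed

text \<open>Take \<open>w < x\<close> and extend the map sending \<open>w\<close> to
  \<open>x\<close>: then \<open>x = f w < f x\<close>.\<close>

lemma IH_no_maximal:
  assumes T: "tree T" "unspined T" and IH: "extends_to partial_I total_H T" and "x \<in> T"
  shows "\<exists>y\<in>T. x < y"
proof -
  obtain w where w: "w \<in> T" "w < x" using unspined_no_minimal[OF T \<open>x \<in> T\<close>] by blast
  have "finite {w}" "{w} \<subseteq> T" "(\<lambda>_. x) \<in> {w} \<rightarrow> T" "partial_I {w} (\<lambda>_. x)"
    using w \<open>x \<in> T\<close> by (simp_all add: partial_I_def)
  then obtain f where f: "f \<in> T \<rightarrow> T" "\<forall>x\<in>T. \<forall>y\<in>T. x < y \<longrightarrow> f x < f y" "\<forall>y\<in>{w}. f y = x"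
    by (rule extends_I_HD[OF IH])
  have "x < f x" using f(2,3) w \<open>x \<in> T\<close> by force
  moreover have "f x \<in> T" using f(1) \<open>x \<in> T\<close> by blast
  ultimately show ?thesis by blast
qed

text \<open>Take \<open>w < x\<close> and extend the map sending \<open>w\<close> to
  \<open>x\<close> and fixing \<open>y\<close>: from \<open>w < x < y\<close> it follows that
  \<open>x < f x < y\<close>.\<close>

lemma IH_dense:
  assumes T: "tree T" "unspined T" and IH: "extends_to partial_I total_H T"
    and xy: "x \<in> T" "y \<in> T" "x < y"
  shows "\<exists>z\<in>T. x < z \<and> z < y"
proof -
  obtain w where w: "w \<in> T" "w < x" using unspined_no_minimal[OF T \<open>x \<in> T\<close>] by blast
  define p where "p = (\<lambda>v. if v = w then x else y)"
  have p: "p w = x" "p y = y" using w xy by (auto simp: p_def)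
  have "w < y" using w xy by (blast intro: order.strict_trans)
  have "finite {w, y}" "{w, y} \<subseteq> T" "p \<in> {w, y} \<rightarrow> T" using w xy p by auto
  moreover have "partial_I {w, y} p"
    unfolding partial_I_def inj_on_def
    using \<open>w < y\<close> \<open>x < y\<close> by (auto simp: p)
  ultimately obtain f where f: "f \<in> T \<rightarrow> T"
    "\<forall>x\<in>T. \<forall>y\<in>T. x < y \<longrightarrow> f x < f y" "\<forall>v\<in>{w, y}. f v = p v"
    by (rule extends_I_HD[OF IH])
  have "f w < f x" "f x < f y" using f(2) w xy by blast+
  then have "x < f x" "f x < y" using f(3) p by simp_all
  moreover have "f x \<in> T" using f(1) xy by blast
  ultimately show ?thesis by blast
qed

text \<open>If \<open>v1 \<parallel> v2\<close>, then \<open>{d, u1, u2}\<close> and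
  \<open>{a, v1, v2}\<close> are isomorphic, and an extension of the isomorphism carries
  \<open>x\<close> to the desired point. If \<open>v1\<close> and \<open>v2\<close> are comparable,
  density between \<open>a\<close> and the smaller one suffices.\<close>

lemma IH_insert_between2:
  assumes T: "tree T" "unspined T" and IH: "extends_to partial_I total_H T"
    and dx: "d \<in> T" "x \<in> T" "u1 \<in> T" "u2 \<in> T" "d < x" "x < u1" "x < u2" "u1 \<parallel> u2"
    and av: "a \<in> T" "v1 \<in> T" "v2 \<in> T" "a < v1" "a < v2"
  shows "\<exists>q\<in>T. a < q \<and> q < v1 \<and> q < v2"
proof (cases "v1 \<parallel> v2")
  case True
  define p where "p = (\<lambda>w. if w = d then a else if w = u1 then v1 else v2)"
  have du: "d < u1" "d < u2" using dx by (blast intro: order.strict_trans)+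
  then have p: "p d = a" "p u1 = v1" "p u2 = v2"
    using dx(8) by (auto simp: p_def incomparable_def)
  have "finite {d, u1, u2}" "{d, u1, u2} \<subseteq> T" "p \<in> {d, u1, u2} \<rightarrow> T"
    using dx(1-4) av(1-3) p by auto
  moreover have "partial_I {d, u1, u2} p"
    using av(4,5) True du dx(8) unfolding partial_I_def inj_on_def incomparable_def less_le_not_le
    by (simp add: p) blast
  ultimately obtain f where f: "f \<in> T \<rightarrow> T"
    "\<forall>x\<in>T. \<forall>y\<in>T. x < y \<longrightarrow> f x < f y" "\<forall>v\<in>{d, u1, u2}. f v = p v"
    by (rule extends_I_HD[OF IH])
  have "f d < f x" "f x < f u1" "f x < f u2" using f(2) dx by blast+
  then have "a < f x" "f x < v1" "f x < v2" using f(3) p by simp_all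
  moreover have "f x \<in> T" using f(1) dx(2) by blast
  ultimately show ?thesis by blast
next
  case False
  then consider "v1 \<le> v2" | "v2 \<le> v1" by (auto simp: incomparable_def)
  then show ?thesis
  proof cases
    case 1
    obtain q where "q \<in> T" "a < q" "q < v1" using IH_dense[OF T IH av(1,2,4)] by blast
    with order.strict_trans2[OF _ 1] show ?thesis by blast
  next
    case 2
    obtain q where "q \<in> T" "a < q" "q < v2" using IH_dense[OF T IH av(1,3,5)] by blast
    with order.strict_trans2[OF _ 2] show ?thesis by blast
  qed
qed

text \<open>Induction on \<open>V\<close>: the point \<open>q\<close> found for the earlier elements
  and the new element \<open>v\<close> are both above \<open>a\<close>, so the case of two points
  yields \<open>r\<close> below both.\<close>

lemma IH_insert_between:
  assumes T: "tree T" "unspined T" and IH: "extends_to partial_I total_H T"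
    and dx: "d \<in> T" "x \<in> T" "u1 \<in> T" "u2 \<in> T" "d < x" "x < u1" "x < u2" "u1 \<parallel> u2"
    and "a \<in> T" "finite V" "V \<subseteq> T" "\<forall>v\<in>V. a < v"
  shows "\<exists>q\<in>T. a < q \<and> (\<forall>v\<in>V. q < v)"
  using \<open>finite V\<close> \<open>V \<subseteq> T\<close> \<open>\<forall>v\<in>V. a < v\<close>
proof (induction V)
  case empty
  then show ?case using IH_no_maximal[OF T IH \<open>a \<in> T\<close>] by simp
next
  case (insert v V)
  then obtain q where q: "q \<in> T" "a < q" "\<forall>v\<in>V. q < v" by auto
  then obtain r where "r \<in> T" "a < r" "r < q" "r < v"
    using IH_insert_between2[OF T IH dx \<open>a \<in> T\<close>, of q v] insert.prems by auto
  with q show ?case using order.strict_trans by blast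
qed

lemma IH_extend_strict:
  assumes T: "tree T" "T \<noteq> {}" "unspined T" and IH: "extends_to partial_I total_H T"
    and A: "finite A" "A \<subseteq> T" "p \<in> A \<rightarrow> T" "\<forall>x\<in>A. \<forall>y\<in>A. x < y \<longrightarrow> p x < p y"
    and x: "x \<in> T" and F: "finite F"
  shows "\<exists>q\<in>T. q \<notin> F \<and> (\<forall>a\<in>A. (a < x \<longrightarrow> p a < q) \<and> (x < a \<longrightarrow> q < p a))"
proof -
  define S where "S = {q\<in>T. \<forall>a\<in>A. (a < x \<longrightarrow> p a < q) \<and> (x < a \<longrightarrow> q < p a)}"
  have "S \<noteq> {} \<and> (\<forall>q\<in>S. \<exists>r\<in>S. r < q)"
  proof (cases "\<exists>a\<in>A. a < x")
    case True
    then obtain d where d: "d \<in> A" "d < x" "\<forall>a\<in>A. a < x \<longrightarrow> a \<le> d"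
      using tree_max_below[OF T(1) A(1,2) x(1)] by blast
    have dT: "d \<in> T" "p d \<in> T" using d A by auto
    \<comment> \<open>All lower constraints reduce to the single one \<open>p d < q\<close>, since
      \<open>d\<close> is the largest point of \<open>A\<close> below \<open>x\<close>.\<close>
    have S_I: "q \<in> S" if "q \<in> T" "p d < q" "\<forall>a\<in>A. x < a \<longrightarrow> q < p a" for q
    proof -
      have "p a < q" if "a \<in> A" "a < x" for a
      proof (cases "a = d")
        case False
        then have "p a < p d" using that d A(4) by (simp add: less_le)
        then show ?thesis using \<open>p d < q\<close> by (rule order.strict_trans)
      qed (use \<open>p d < q\<close> in simp)
      with that show ?thesis by (simp add: S_def)
    qed
    have "\<exists>q\<in>T. p d < q \<and> (\<forall>a\<in>A. x < a \<longrightarrow> q < p a)"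
    \<comment> \<open>Two incomparable points of \<open>A\<close> above \<open>x\<close> supply the
      configuration that \<open>IH_insert_between\<close> moves. Otherwise the points of
      \<open>A\<close> above \<open>x\<close> form a chain; if there are any, the least one
      \<open>u\<close> has the least value, and density between \<open>p d\<close> and
      \<open>p u\<close> is enough.\<close>
    proof (cases "\<exists>u1\<in>A. \<exists>u2\<in>A. x < u1 \<and> x < u2 \<and> u1 \<parallel> u2")
      case True
      then obtain u1 u2 where u: "u1 \<in> T" "u2 \<in> T" "x < u1" "x < u2" "u1 \<parallel> u2"
        using A(2) by blast
      have "p d < p a" if "a \<in> A" "x < a" for a
        using A(4) d(1) that order.strict_trans[OF d(2) that(2)] by blast
      then have "\<forall>v\<in>p ` {a\<in>A. x < a}. p d < v" by blast
      moreover have "finite (p ` {a\<in>A. x < a})" "p ` {a\<in>A. x < a} \<subseteq> T" using A(1,3) by auto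
      ultimately have "\<exists>q\<in>T. p d < q \<and> (\<forall>v\<in>p ` {a\<in>A. x < a}. q < v)"
        using IH_insert_between[OF T(1,3) IH dT(1) x u(1,2) d(2) u(3-5) dT(2)] by blast
      then show ?thesis by auto
    next
      case chain: False
      show ?thesis
      proof (cases "\<exists>a\<in>A. x < a")
        case True
        then obtain u where u: "u \<in> {a\<in>A. x < a}" "\<And>b. b \<in> {a\<in>A. x < a} \<Longrightarrow> b \<le> u \<Longrightarrow> u = b"
          using finite_has_minimal[of "{a\<in>A. x < a}"] A(1) by auto
        have "p d < p u" using A(4) d(1) u(1) order.strict_trans[OF d(2), of u] by blast
        moreover have "p u \<in> T" using u(1) A(3) by auto
        ultimately obtain q where q: "q \<in> T" "p d < q" "q < p u"
          using IH_dense[OF T(1,3) IH dT(2)] by blast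
        have "q < p a" if "a \<in> A" "x < a" for a
        proof (cases "a = u")
          case False
          have "u \<le> a \<or> a \<le> u" using that u(1) chain by (auto simp: incomparable_def)
          with False u(2)[of a] that have "u < a" by (auto simp: less_le)
          then have "p u < p a" using that u(1) A(4) by simp
          with q(3) show ?thesis by (rule order.strict_trans)
        qed (use q in simp)
        with q show ?thesis by blast
      qed (use IH_no_maximal[OF T(1,3) IH dT(2)] in auto)
    qed
    then obtain q where "q \<in> S" using S_I by blast
    moreover have "\<exists>r\<in>S. r < q" if "q \<in> S" for q
    proof -
      have q: "q \<in> T" "p d < q" "\<And>a. a \<in> A \<Longrightarrow> x < a \<Longrightarrow> q < p a"
        \<comment> \<open>Any value strictly between \<open>p d\<close> and \<open>q\<close> is
          again admissible, so \<open>q\<close> is not minimal in \<open>S\<close>.\<close>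
        using that d by (simp_all add: S_def)
      obtain r where r: "r \<in> T" "p d < r" "r < q"
        using IH_dense[OF T(1,3) IH dT(2) q(1,2)] by blast
      have "r < p a" if "a \<in> A" "x < a" for a
        using r(3) q(3)[OF that] by (rule order.strict_trans)
      with r S_I show ?thesis by blast
    qed
    ultimately show ?thesis by blast
  next
    case False
    \<comment> \<open>With no point of \<open>A\<close> below \<open>x\<close> there are only upper
      constraints: go strictly below a lower bound of all values, and then ever further
      down.\<close>
    have "finite (p ` A)" "p ` A \<subseteq> T" using A by auto
    then obtain z where z: "z \<in> T" "\<forall>a\<in>p ` A. z \<le> a"
      using tree_lower_bound[OF T(1,2)] by blast
    obtain q where q: "q \<in> T" "q < z" using unspined_no_minimal[OF T(1,3) z(1)] by blast
    have "q < p a" if "a \<in> A" for a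
      using order.strict_trans2[OF q(2)] z(2) that by blast
    with q False have "q \<in> S" by (auto simp: S_def)
    moreover have "\<exists>r\<in>S. r < q" if "q \<in> S" for q
    proof -
      have q: "q \<in> T" "\<And>a. a \<in> A \<Longrightarrow> x < a \<Longrightarrow> q < p a" using that by (simp_all add: S_def)
      obtain r where r: "r \<in> T" "r < q" using unspined_no_minimal[OF T(1,3) q(1)] by blast
      have "r < p a" if "a \<in> A" "x < a" for a
        using r(2) q(2)[OF that] by (rule order.strict_trans)
      with r False have "r \<in> S" by (auto simp: S_def)
      with r show ?thesis by blast
    qed
    ultimately show ?thesis by blast
  qed
  then have "infinite S" using finite_has_minimal[of S] by (auto simp: less_le)
  then have "\<not> S \<subseteq> F" using F finite_subset by blast
  then show ?thesis by (auto simp: S_def)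
qed

section \<open>Back-and-forth for strict maps, without and with injectivity\<close>

lemma extends_H_E:
  assumes "countable T" and T: "tree T" "T \<noteq> {}" "unspined T"
    and IH: "extends_to partial_I total_H T"
  shows "extends_to partial_H total_E T"
  unfolding extends_to_def
proof (intro allI impI, elim conjE)
  fix A and p :: "'a \<Rightarrow> 'a"
  assume A: "finite A" "A \<subseteq> T" "p \<in> A \<rightarrow> T" and p: "partial_H A p"
  have "\<exists>f. f \<in> T \<rightarrow> T \<and> f ` T = T \<and> (\<forall>x\<in>T. \<forall>y\<in>T. x < y \<longrightarrow> f x < f y) \<and> (\<forall>x\<in>A. f x = p x)"
  proof (rule back_and_forth[OF \<open>countable T\<close> \<open>countable T\<close> A])
    show "\<forall>x\<in>A. \<forall>y\<in>A. x < y \<longrightarrow> p x < p y"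
      using p by (auto simp: partial_H_def strict_mono_on_def)
  next
    fix A and p :: "'a \<Rightarrow> 'a" and x
    assume A: "finite A" "A \<subseteq> T" "p \<in> A \<rightarrow> T" "\<forall>x\<in>A. \<forall>y\<in>A. x < y \<longrightarrow> p x < p y"
      and x: "x \<in> T"
    show "\<exists>y\<in>T. (x < x \<longrightarrow> y < y) \<and> (\<forall>a\<in>A. (a < x \<longrightarrow> p a < y) \<and> (x < a \<longrightarrow> y < p a))"
      using IH_extend_strict[OF T IH A x finite.emptyI] by auto
  next
    fix A and p :: "'a \<Rightarrow> 'a" and y
    assume A: "finite A" "A \<subseteq> T"
    show "\<exists>x\<in>T. x \<notin> A \<and> (x < x \<longrightarrow> y < y) \<and>
        (\<forall>a\<in>A. (a < x \<longrightarrow> p a < y) \<and> (x < a \<longrightarrow> y < p a))"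
      using tree_incomparable_to_finite[OF T A] by (fastforce simp: incomparable_def)
  qed
  then show "\<exists>f. f \<in> T \<rightarrow> T \<and> total_E T f \<and> (\<forall>x\<in>A. f x = p x)"
    by (auto simp: total_E_def strict_mono_on_def)
qed

text \<open>Injectivity is carried inside the relation as
  \<open>f x = f y \<longrightarrow> x = y\<close>. A new point of the domain gets a value outside
  \<open>p\<close> A\<open>; a new value\<close>y\<open>is outside\<close>p \<open>A\<close> by the
  hypothesis of \<open>hit\<close>.\<close>

lemma extends_M_B:
  assumes "countable T" and T: "tree T" "T \<noteq> {}" "unspined T"
    and IH: "extends_to partial_I total_H T"
  shows "extends_to partial_M total_B T"
  unfolding extends_to_def
proof (intro allI impI, elim conjE)
  fix A and p :: "'a \<Rightarrow> 'a"
  assume A: "finite A" "A \<subseteq> T" "p \<in> A \<rightarrow> T" and p: "partial_M A p"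
  have "\<exists>f. f \<in> T \<rightarrow> T \<and> f ` T = T \<and>
      (\<forall>x\<in>T. \<forall>y\<in>T. (x < y \<longrightarrow> f x < f y) \<and> (f x = f y \<longrightarrow> x = y)) \<and> (\<forall>x\<in>A. f x = p x)"
  proof (rule back_and_forth[OF \<open>countable T\<close> \<open>countable T\<close> A])
    show "\<forall>x\<in>A. \<forall>y\<in>A. (x < y \<longrightarrow> p x < p y) \<and> (p x = p y \<longrightarrow> x = y)"
      using p by (auto simp: partial_M_def strict_mono_on_def inj_on_def)
  next
    fix A and p :: "'a \<Rightarrow> 'a" and x
    assume A: "finite A" "A \<subseteq> T" "p \<in> A \<rightarrow> T"
        "\<forall>x\<in>A. \<forall>y\<in>A. (x < y \<longrightarrow> p x < p y) \<and> (p x = p y \<longrightarrow> x = y)"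
      and x: "x \<in> T"
    have "\<forall>x\<in>A. \<forall>y\<in>A. x < y \<longrightarrow> p x < p y" using A(4) by blast
    from IH_extend_strict[OF T IH A(1-3) this x, of "p ` A"] A(1)
    obtain q where "q \<in> T" "q \<notin> p ` A" "\<forall>a\<in>A. (a < x \<longrightarrow> p a < q) \<and> (x < a \<longrightarrow> q < p a)"
      by blast
    then show "\<exists>y\<in>T. ((x < x \<longrightarrow> y < y) \<and> (y = y \<longrightarrow> x = x)) \<and>
        (\<forall>a\<in>A. ((a < x \<longrightarrow> p a < y) \<and> (p a = y \<longrightarrow> a = x)) \<and>
          ((x < a \<longrightarrow> y < p a) \<and> (y = p a \<longrightarrow> x = a)))"
      by (intro bexI[of _ q]) auto
  next
    fix A and p :: "'a \<Rightarrow> 'a" and y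
    assume A: "finite A" "A \<subseteq> T" and y: "y \<notin> p ` A"
    obtain x where x: "x \<in> T" "\<forall>a\<in>A. x \<parallel> a" using tree_incomparable_to_finite[OF T A] by blast
    with y show "\<exists>x\<in>T. x \<notin> A \<and> ((x < x \<longrightarrow> y < y) \<and> (y = y \<longrightarrow> x = x)) \<and>
        (\<forall>a\<in>A. ((a < x \<longrightarrow> p a < y) \<and> (p a = y \<longrightarrow> a = x)) \<and>
          ((x < a \<longrightarrow> y < p a) \<and> (y = p a \<longrightarrow> x = a)))"
      by (intro bexI[of _ x]) (auto simp: incomparable_def)
  qed
  then show "\<exists>f. f \<in> T \<rightarrow> T \<and> total_B T f \<and> (\<forall>x\<in>A. f x = p x)"
    by (auto simp: total_B_def strict_mono_on_def bij_betw_def inj_on_def)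
qed

theorem lemma2p8:
  fixes T :: "'a::order set"
  assumes "countable T" and "tree T" and "nontrivial T"
  shows "((extends_to partial_I total_Ebar T \<longleftrightarrow> extends_to partial_Hbar total_Ebar T) \<and>
          (extends_to partial_Hbar total_Ebar T \<longleftrightarrow> (\<forall>x\<in>T. \<exists>y\<in>T. x \<parallel> y))) \<and>
         ((extends_to partial_I total_E T \<longleftrightarrow>
             extends_to partial_H total_E T \<and> extends_to partial_M total_B T) \<and>
          (extends_to partial_H total_E T \<and> extends_to partial_M total_B T \<longleftrightarrow>
             extends_to partial_I total_H T \<and> (\<forall>x\<in>T. \<exists>y\<in>T. x \<parallel> y)))"
proof -
  have ne: "T \<noteq> {}" using assms(3) by (auto simp: nontrivial_def)
  have I_Ebar: "extends_to partial_I total_Ebar T \<Longrightarrow> unspined T"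
    using unspined_if_extends_I_Ebar assms by blast
  have "unspined T \<Longrightarrow> extends_to partial_Hbar total_Ebar T"
    using extends_Hbar_Ebar assms ne by blast
  moreover have "extends_to partial_Hbar total_Ebar T \<Longrightarrow> extends_to partial_I total_Ebar T"
    by (erule extends_to_weaken) (rule partial_I_imp_partial_Hbar)
  moreover have "extends_to partial_H total_E T \<Longrightarrow> extends_to partial_I total_E T"
    by (erule extends_to_weaken) (rule partial_I_imp_partial_H)
  moreover have "extends_to partial_I total_E T \<Longrightarrow> extends_to partial_I total_H T"
    by (erule extends_to_weaken) (simp_all add: total_E_def total_H_def)
  \<comment> \<open>This feeds \<open>I_Ebar\<close>, so IE yields the incomparability condition as
    well as IH, and the second cycle closes.\<close>
  moreover have "extends_to partial_I total_E T \<Longrightarrow> extends_to partial_I total_Ebar T"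
    by (erule extends_to_weaken) (simp_all add: total_E_imp_total_Ebar)
  moreover have "extends_to partial_H total_E T \<and> extends_to partial_M total_B T"
    if "extends_to partial_I total_H T" "unspined T"
    using that extends_H_E extends_M_B assms ne by blast
  ultimately show ?thesis using I_Ebar unfolding unspined_def by blast
qed

end
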